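(* Let $X$ be a separable complex Hilbert space and let $A:D(A)\subset X\to X$ be an unbounded sectorial operator with compact resolvent such that, for some $\lambda_0>0$, $\mathrm{Re}\,\lambda>\lambda_0$ for all $\lambda\in\sigma(A)$. Let $Z=X^{\frac23}\times X^{\frac13}\times X$ and let $\mathbb{B}_{(1)}:D(\mathbb{B}_{(1)})\subset Z\to Z$ be defined by $D(\mathbb{B}_{(1)})=X^1\times X^{\frac23}\times X^{\frac13}$ and $$\mathbb{B}_{(1)}\begin{bmatrix} u\\ v\\ w\end{bmatrix}=\begin{bmatrix} A^{\frac13}u-v\\ -w\\ A^{\frac23}v\end{bmatrix}.$$ Then $-\mathbb{B}_{(1)}$ is not a dissipative operator on $Z$; that is, there exists $U\in D(\mathbb{B}_{(1)})$ with $\mathrm{Re}\langle -\mathbb{B}_{(1)}U,U\rangle_Z>0$.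
   Context: For $\alpha\in(0,1]$, $A^{\alpha}$ denotes the fractional power of $A$, $X^\alpha=D(A^\alpha)$ with inner product $\langle x,y\rangle_{X^\alpha}=\langle A^\alpha x,A^\alpha y\rangle_X$, and $X^0=X$. $Z$ is the Hilbert space with inner product $\langle (u,v,w),(u',v',w')\rangle_Z=\langle u,u'\rangle_{X^{2/3}}+\langle v,v'\rangle_{X^{1/3}}+\langle w,w'\rangle_X$. An operator $L$ on $Z$ is dissipative if $\mathrm{Re}\langle LU,U\rangle_Z\leqslant0$ for all $U\in D(L)$. *)

theory Defs
  imports "HOL-Analysis.Analysis"
begin

class complex_vector = real_vector +
  fixes scaleC :: "complex \<Rightarrow> 'a \<Rightarrow> 'a"  (infixr \<open>*\<^sub>C\<close> 75)
  assumes scaleC_add_right: "scaleC a (x + y) = scaleC a x + scaleC a y"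
    and scaleC_add_left: "scaleC (a + b) x = scaleC a x + scaleC b x"
    and scaleC_scaleC: "scaleC a (scaleC b x) = scaleC (a * b) x"
    and scaleC_one: "scaleC 1 x = x"
    and scaleR_scaleC: "scaleR r x = scaleC (complex_of_real r) x"

class complex_inner = complex_vector + real_normed_vector +
  fixes cinner :: "'a \<Rightarrow> 'a \<Rightarrow> complex"
  assumes cinner_commute: "cinner x y = cnj (cinner y x)"
    and cinner_add_left: "cinner (x + y) z = cinner x z + cinner y z"
    and cinner_scaleC_left: "cinner (scaleC r x) y = cnj r * cinner x y"
    and cinner_real_nonneg: "Im (cinner x x) = 0 \<and> 0 \<le> Re (cinner x x)"
    and cinner_eq_zero_iff: "cinner x x = 0 \<longleftrightarrow> x = 0"
    and norm_eq_sqrt_cinner: "norm x = sqrt (Re (cinner x x))"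

class chilbert_space = complex_inner + complete_space

instantiation complex :: chilbert_space
begin
definition scaleC_complex_def: "scaleC a (x::complex) = a * x"
definition cinner_complex_def: "cinner (x::complex) y = cnj x * y"
instance
proof
  fix x :: complex
  show "norm x = sqrt (Re (cinner x x))"
    by (simp add: cinner_complex_def cmod_def power2_eq_square)
qed (auto simp: scaleC_complex_def cinner_complex_def algebra_simps scaleR_conv_of_real)
end

definition separable :: "'a::topological_space itself \<Rightarrow> bool" where
  "separable _ \<longleftrightarrow> (\<exists>S::'a set. countable S \<and> closure S = UNIV)"

definition linear_op :: "'x::complex_vector set \<Rightarrow> ('x \<Rightarrow> 'x) \<Rightarrow> bool" where
  "linear_op D A \<longleftrightarrow> 0 \<in> D \<and> (\<forall>x\<in>D. \<forall>y\<in>D. x + y \<in> D \<and> A (x + y) = A x + A y)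
     \<and> (\<forall>c. \<forall>x\<in>D. c *\<^sub>C x \<in> D \<and> A (c *\<^sub>C x) = c *\<^sub>C A x)"

definition closed_op :: "'x::real_normed_vector set \<Rightarrow> ('x \<Rightarrow> 'x) \<Rightarrow> bool" where
  "closed_op D A \<longleftrightarrow> (\<forall>f x y. (\<forall>n. f n \<in> D) \<longrightarrow> f \<longlonglongrightarrow> x \<longrightarrow> (\<lambda>n. A (f n)) \<longlonglongrightarrow> y
       \<longrightarrow> x \<in> D \<and> A x = y)"

definition unbounded_op :: "'x::real_normed_vector set \<Rightarrow> ('x \<Rightarrow> 'x) \<Rightarrow> bool" where
  "unbounded_op D A \<longleftrightarrow> \<not> (\<exists>C. \<forall>x\<in>D. norm (A x) \<le> C * norm x)"

definition resolvent_op :: "'x::complex_vector set \<Rightarrow> ('x \<Rightarrow> 'x) \<Rightarrow> complex \<Rightarrow> 'x \<Rightarrow> 'x" where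
  "resolvent_op D A l x = (THE y. y \<in> D \<and> l *\<^sub>C y - A y = x)"

definition in_resolvent_set :: "'x::{complex_vector,real_normed_vector} set \<Rightarrow> ('x \<Rightarrow> 'x) \<Rightarrow> complex \<Rightarrow> bool" where
  "in_resolvent_set D A l \<longleftrightarrow> (\<forall>x. \<exists>!y. y \<in> D \<and> l *\<^sub>C y - A y = x)
      \<and> (\<exists>C. \<forall>x. norm (resolvent_op D A l x) \<le> C * norm x)"

definition spectrum_op :: "'x::{complex_vector,real_normed_vector} set \<Rightarrow> ('x \<Rightarrow> 'x) \<Rightarrow> complex set" where
  "spectrum_op D A = {l. \<not> in_resolvent_set D A l}"

text \<open>Sectorial operator in the sense of Henry: closed, densely defined, and for some
  \<open>a \<in> \<real>\<close>, \<open>0 < \<phi> < \<pi>/2\<close>, \<open>M \<ge> 1\<close> the sector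
  \<open>S_{a,\<phi>} = {\<lambda> | \<phi> \<le> |arg(\<lambda> - a)| \<le> \<pi>, \<lambda> \<noteq> a}\<close> lies in the resolvent set and
  \<open>\<parallel>(\<lambda> - A)\<^sup>-\<^sup>1\<parallel> \<le> M / |\<lambda> - a|\<close> there.\<close>
definition sectorial :: "'x::{complex_vector,real_normed_vector} set \<Rightarrow> ('x \<Rightarrow> 'x) \<Rightarrow> bool" where
  "sectorial D A \<longleftrightarrow> linear_op D A \<and> closed_op D A \<and> closure D = UNIV \<and>
     (\<exists>a::real. \<exists>\<phi> M. 0 < \<phi> \<and> \<phi> < pi / 2 \<and> 1 \<le> M \<and>
        (\<forall>l. l \<noteq> complex_of_real a \<and> \<phi> \<le> \<bar>Arg (l - complex_of_real a)\<bar> \<longrightarrow>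
            in_resolvent_set D A l \<and>
            (\<forall>x. norm (resolvent_op D A l x) \<le> M / cmod (l - complex_of_real a) * norm x)))"

definition compact_resolvent :: "'x::{complex_vector,real_normed_vector} set \<Rightarrow> ('x \<Rightarrow> 'x) \<Rightarrow> bool" where
  "compact_resolvent D A \<longleftrightarrow> (\<exists>l. in_resolvent_set D A l \<and>
      (\<forall>B. bounded B \<longrightarrow> compact (closure (resolvent_op D A l ` B))))"

section \<open>Fractional powers (Balakrishnan formula), fractional power spaces\<close>

definition frac_neg_pow :: "'x::{complex_vector,real_normed_vector} set \<Rightarrow> ('x \<Rightarrow> 'x) \<Rightarrow> real \<Rightarrow> 'x \<Rightarrow> 'x" where
  "frac_neg_pow D A \<alpha> x = (sin (pi * \<alpha>) / pi) *\<^sub>R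
      integral {0<..} (\<lambda>t::real. (t powr (- \<alpha>)) *\<^sub>R (THE y. y \<in> D \<and> t *\<^sub>R y + A y = x))"

text \<open>\<open>X\<^sup>\<alpha> = D(A\<^sup>\<alpha>)\<close> for \<open>\<alpha> \<in> [0,1]\<close> (with \<open>X\<^sup>0 = X\<close>, \<open>X\<^sup>1 = D(A)\<close>, and
  \<open>A\<^sup>\<alpha> = (A\<^sup>-\<^sup>\<alpha>)\<^sup>-\<^sup>1\<close>, \<open>D(A\<^sup>\<alpha>) = range A\<^sup>-\<^sup>\<alpha>\<close> for \<open>0 < \<alpha> < 1\<close>).\<close>
definition frac_dom :: "'x::{complex_vector,real_normed_vector} set \<Rightarrow> ('x \<Rightarrow> 'x) \<Rightarrow> real \<Rightarrow> 'x set" where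
  "frac_dom D A \<alpha> = (if \<alpha> = 0 then UNIV else if \<alpha> = 1 then D else range (frac_neg_pow D A \<alpha>))"

definition frac_pow :: "'x::{complex_vector,real_normed_vector} set \<Rightarrow> ('x \<Rightarrow> 'x) \<Rightarrow> real \<Rightarrow> 'x \<Rightarrow> 'x" where
  "frac_pow D A \<alpha> x = (if \<alpha> = 0 then x else if \<alpha> = 1 then A x
      else (THE y. frac_neg_pow D A \<alpha> y = x))"

definition frac_inner :: "'x::complex_inner set \<Rightarrow> ('x \<Rightarrow> 'x) \<Rightarrow> real \<Rightarrow> 'x \<Rightarrow> 'x \<Rightarrow> complex" where
  "frac_inner D A \<alpha> x y = cinner (frac_pow D A \<alpha> x) (frac_pow D A \<alpha> y)"

definition Z_inner :: "'x::complex_inner set \<Rightarrow> ('x \<Rightarrow> 'x) \<Rightarrow> 'x \<times> 'x \<times> 'x \<Rightarrow> 'x \<times> 'x \<times> 'x \<Rightarrow> complex" where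
  "Z_inner D A U U' = (case U of (u, v, w) \<Rightarrow> case U' of (u', v', w') \<Rightarrow>
      frac_inner D A (2/3) u u' + frac_inner D A (1/3) v v' + cinner w w')"

definition B1_dom :: "'x::complex_inner set \<Rightarrow> ('x \<Rightarrow> 'x) \<Rightarrow> ('x \<times> 'x \<times> 'x) set" where
  "B1_dom D A = frac_dom D A 1 \<times> frac_dom D A (2/3) \<times> frac_dom D A (1/3)"

definition B1 :: "'x::complex_inner set \<Rightarrow> ('x \<Rightarrow> 'x) \<Rightarrow> 'x \<times> 'x \<times> 'x \<Rightarrow> 'x \<times> 'x \<times> 'x" where
  "B1 D A U = (case U of (u, v, w) \<Rightarrow>
      (frac_pow D A (1/3) u - v, - w, frac_pow D A (2/3) v))"

definition dissipative :: "('z \<Rightarrow> 'z \<Rightarrow> complex) \<Rightarrow> 'z set \<Rightarrow> ('z \<Rightarrow> 'z) \<Rightarrow> bool" where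
  "dissipative ip Dom L \<longleftrightarrow> (\<forall>U\<in>Dom. Re (ip (L U) U) \<le> 0)"

end

theory Submission
  imports Defs
begin

text \<open>For \<open>w = 0\<close> and \<open>v = \<tau> u\<close> the quadratic form of \<open>- B\<close> equals
  \<open>\<tau> \<parallel>A\<^sup>2\<^sup>/\<^sup>3 u\<parallel>\<^sup>2 - Re \<langle>A u, A\<^sup>2\<^sup>/\<^sup>3 u\<rangle>\<close>, which is positive for large real \<open>\<tau>\<close>. Taking
  \<open>u = A\<^sup>-\<^sup>1 A\<^sup>-\<^sup>1\<^sup>/\<^sup>3 A\<^sup>-\<^sup>2\<^sup>/\<^sup>3 z\<close> with \<open>z \<noteq> 0\<close>, only two facts about the negative powers are needed: they
  commute with each other and with \<open>A\<^sup>-\<^sup>1\<close>, and they are injective.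

  Injectivity: let \<open>R(t) = (t + A)\<^sup>-\<^sup>1\<close>, and suppose that \<open>t\<^sup>-\<^sup>a R(t) x\<close> has integral zero over \<open>t > 0\<close>.
  For a continuous linear functional \<open>h\<close> put \<open>p(s) = h (R(s) x)\<close>. Substituting \<open>t = s r\<close>, the
  function \<open>r\<^sup>-\<^sup>a h (R(s) R(s r) x)\<close> of \<open>r\<close> has integral zero for every \<open>s > 0\<close>. Its integral over
  \<open>s\<close> is \<open>r\<^sup>-\<^sup>a p(0) ln r / (r - 1)\<close>, because the resolvent identity turns it into a Frullani integral.
  By Fubini the integral of the latter over \<open>r\<close> vanishes, whence \<open>h (A\<^sup>-\<^sup>1 x) = p(0) = 0\<close>.\<close>

section \<open>A Frullani integral\<close>

definition powr_pieces :: "real \<Rightarrow> real \<Rightarrow> real \<Rightarrow> real" where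
  "powr_pieces p q s = (if s \<le> 0 then 0 else if s \<le> 1 then s powr - p else s powr - q)"

lemma powr_pieces_nonneg: "0 \<le> powr_pieces p q s"
  by (simp add: powr_pieces_def)

lemma powr_pieces_measurable [measurable]: "powr_pieces p q \<in> borel_measurable borel"
  unfolding powr_pieces_def [abs_def] by measurable

lemma powr_pieces_integrable_on:
  assumes "p < 1" "1 < q"
  shows "powr_pieces p q integrable_on UNIV"
proof -
  have 1: "(powr_pieces p q) integrable_on {0..1}"
  proof (rule integrable_spike_finite [of "{0}"])
    show "(\<lambda>s. s powr - p) integrable_on {0..1}"
      using assms by (intro integrable_on_powr_from_0) auto
  qed (auto simp: powr_pieces_def)
  have 2: "(powr_pieces p q) integrable_on {1..}"
  proof (rule integrable_spike_finite [of "{}"])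
    show "(\<lambda>s. s powr - q) integrable_on {1..}"
      using has_integral_powr_to_inf [of "- q" 1] assms by (auto simp: integrable_on_def)
  qed (auto simp: powr_pieces_def)
  have "(powr_pieces p q) integrable_on ({0..1} \<union> {1..})"
    using 1 2 by (rule integrable_Un [rotated]) (auto intro: negligible_subset [of "{1}"])
  then show ?thesis
    by (rule integrable_on_superset) (auto simp: powr_pieces_def)
qed

lemma powr_pieces_integrable:
  assumes "p < 1" "1 < q"
  shows "integrable lborel (powr_pieces p q)"
proof -
  have "powr_pieces p q absolutely_integrable_on UNIV"
    using powr_pieces_integrable_on [OF assms]
    by (subst absolutely_integrable_on_iff_nonneg) (auto simp: powr_pieces_nonneg)
  then show ?thesis
    by (simp add: set_integrable_def integrable_completion)
qed

text \<open>The denominator 1 + t is at least 1, which suffices near the origin, and at least t,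
  which gains one power at infinity.\<close>

lemma powr_over_one_plus_le:
  assumes "0 < t" "0 < a" 
  shows "t powr - a / (1 + t) \<le> powr_pieces a (1 + a) t"
proof (cases "t \<le> 1")
  case True
  have "t powr - a / (1 + t) \<le> t powr - a / 1"
    using assms by (intro divide_left_mono) auto
  then show ?thesis using True assms by (simp add: powr_pieces_def)
next
  case False
  have "t powr - a / (1 + t) \<le> t powr - a / t"
    using assms by (intro divide_left_mono) auto
  also have "\<dots> = t powr - (1 + a)"
    using assms by (simp add: powr_diff powr_minus powr_add field_simps)
  finally show ?thesis using False assms by (simp add: powr_pieces_def)
qed

lemma powr_le_one_plus:
  fixes x c :: real
  assumes "0 < x" "0 \<le> c" "c \<le> 1"
  shows "x powr c \<le> 1 + x"
proof (cases "x \<le> 1")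
  case True
  then have "x powr c \<le> 1 powr c" using assms by (intro powr_mono2) auto
  then show ?thesis using assms by simp
next
  case False
  then have "x powr c \<le> x powr 1" using assms by (intro powr_mono) auto
  then show ?thesis using assms by simp
qed

text \<open>The denominator is split by \<open>(s r)\<^sup>c \<le> 1 + s r\<close>, with one exponent \<open>c\<close> near
  \<open>r = 0\<close> and a larger one near \<open>r = \<infinity>\<close>, so that both factors of the bound are integrable.\<close>

lemma dilation_kernel_le:
  assumes "0 < s" "0 < r" "0 < a" "a < 1"
  shows "r powr - a / ((1 + s) * (1 + s * r))
    \<le> powr_pieces (1 - a / 2) (1 + (1 - a) / 2) s * powr_pieces ((1 + a) / 2) (1 + a / 2) r"
proof -
  have key: "r powr - a / ((1 + s) * (1 + s * r)) \<le> (s powr - c / (1 + s)) * r powr - (a + c)"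
    if "0 \<le> c" "c \<le> 1" for c
  proof -
    have "(s * r) powr c \<le> 1 + s * r" using assms that by (intro powr_le_one_plus) auto
    then have "r powr - a / ((1 + s) * (1 + s * r)) \<le> r powr - a / ((1 + s) * (s * r) powr c)"
      using assms by (intro divide_left_mono mult_left_mono mult_pos_pos) (auto intro: add_pos_pos)
    also have "\<dots> = (s powr - c / (1 + s)) * r powr - (a + c)"
      using assms by (simp add: powr_mult powr_minus powr_add powr_diff field_simps)
    finally show ?thesis .
  qed
  \<comment> \<open>For r \<le> 1 take c = (1 - a) / 2, so that a + c = (1 + a) / 2 < 1; for r > 1
    take c = 1 - a / 2, so that a + c = 1 + a / 2 > 1. Each resulting bound in s is weakened on one
    side of 1, so that a single majorant, with the larger exponent at 0 and the smaller one at
    infinity, serves both cases.\<close>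
  show ?thesis
  proof (cases "r \<le> 1")
    case True
    have "s powr - ((1 - a) / 2) / (1 + s) \<le> powr_pieces ((1 - a) / 2) (1 + (1 - a) / 2) s"
      using assms by (intro powr_over_one_plus_le) auto
    also have "\<dots> \<le> powr_pieces (1 - a / 2) (1 + (1 - a) / 2) s"
      using assms by (auto simp: powr_pieces_def diff_divide_distrib intro!: powr_mono')
    finally have "(s powr - ((1 - a) / 2) / (1 + s)) * r powr - (a + (1 - a) / 2) \<le>
      powr_pieces (1 - a / 2) (1 + (1 - a) / 2) s * r powr - (a + (1 - a) / 2)"
      by (intro mult_right_mono) auto
    moreover have "r powr - (a + (1 - a) / 2) = powr_pieces ((1 + a) / 2) (1 + a / 2) r"
      using assms True by (simp add: powr_pieces_def field_simps)
    ultimately show ?thesis using key [of "(1 - a) / 2"] assms by simp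
  next
    case False
    have "s powr - (1 - a / 2) / (1 + s) \<le> powr_pieces (1 - a / 2) (1 + (1 - a / 2)) s"
      using assms by (intro powr_over_one_plus_le) auto
    also have "\<dots> \<le> powr_pieces (1 - a / 2) (1 + (1 - a) / 2) s"
      using assms by (auto simp: powr_pieces_def diff_divide_distrib intro!: powr_mono)
    finally have "(s powr - (1 - a / 2) / (1 + s)) * r powr - (a + (1 - a / 2)) \<le>
      powr_pieces (1 - a / 2) (1 + (1 - a) / 2) s * r powr - (a + (1 - a / 2))"
      by (intro mult_right_mono) auto
    moreover have "r powr - (a + (1 - a / 2)) = powr_pieces ((1 + a) / 2) (1 + a / 2) r"
      using assms False by (simp add: powr_pieces_def field_simps)
    ultimately show ?thesis using key [of "1 - a / 2"] assms by simp
  qed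
qed

section \<open>The Frullani integral and the double integral built on it\<close>

lemma has_real_derivative_imp_diff_bound:
  fixes f f' :: "real \<Rightarrow> real"
  assumes "\<And>u. u \<in> closed_segment x y \<Longrightarrow> (f has_real_derivative f' u) (at u)"
    and "\<And>u. u \<in> closed_segment x y \<Longrightarrow> \<bar>f' u\<bar> \<le> B"
  shows "\<bar>f x - f y\<bar> \<le> B * \<bar>x - y\<bar>"
proof -
  have "norm (f x - f y) \<le> B * norm (x - y)"
  proof (rule field_differentiable_bound)
    show "convex (closed_segment x y)" by simp
    show "(f has_field_derivative f' u) (at u within closed_segment x y)"
      if "u \<in> closed_segment x y" for u
      using assms(1) [OF that] by (rule has_field_derivative_at_within)
    show "norm (f' u) \<le> B" if "u \<in> closed_segment x y" for u
      using assms(2) [OF that] by simp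
  qed auto
  then show ?thesis by simp
qed

text \<open>If L is an antiderivative of p(s) / s, then F(s) = L(s) - L(s r) is one of the
  integrand. At 0 it tends to - p(0) ln r, because L(s) - p(0) ln s has bounded derivative; at
  infinity it tends to 0, because the decay of p makes L' of order 1 / s^2.\<close>

lemma frullani_integral:
  fixes p :: "real \<Rightarrow> real"
  assumes r: "0 < r"
    and cont: "continuous_on {0..} p"
    and lip: "\<And>s. 0 < s \<Longrightarrow> \<bar>p s - p 0\<bar> \<le> C * s"
    and decay: "\<And>s. 0 < s \<Longrightarrow> \<bar>p s\<bar> \<le> C / s"
    and int: "set_integrable lborel {0<..} (\<lambda>s. (p s - p (s * r)) / s)"
  shows "set_lebesgue_integral lborel {0<..} (\<lambda>s. (p s - p (s * r)) / s) = p 0 * ln r"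
proof -
  have isc: "isCont p s" if "0 < s" for s
    using continuous_on_interior [OF cont, of s] that by (simp add: interior_real_atLeast)
  have "\<exists>L. \<forall>s::real. (0::ereal) < s \<longrightarrow> s < \<infinity> \<longrightarrow>
      (L has_vector_derivative p s / s) (at s)"
    by (rule einterval_antiderivative) (auto intro!: continuous_intros isc)
  then obtain L where L: "\<And>s. 0 < s \<Longrightarrow> (L has_real_derivative p s / s) (at s)"
    by (auto simp: has_real_derivative_iff_has_vector_derivative)
  define F where "F s = L s - L (s * r)" for s
  have F': "(F has_real_derivative (p s - p (s * r)) / s) (at s)" if "0 < s" for s
  proof -
    have "(F has_real_derivative p s / s - p (s * r) / (s * r) * r) (at s)"
      unfolding F_def using that r
      by (auto intro!: derivative_eq_intros L DERIV_chain2 [OF L])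
    then show ?thesis using that r by (simp add: diff_divide_distrib)
  qed
  have pos: "0 < u" "min s (s * r) \<le> u" if "u \<in> closed_segment s (s * r)" "0 < s" for u s
    using that r by (auto simp: closed_segment_eq_real_ivl min_def split: if_splits intro: less_le_trans mult_pos_pos)
  have "(LBINT s=0..\<infinity>. (p s - p (s * r)) / s) = 0 - (- p 0 * ln r)"
  proof (rule interval_integral_FTC_integrable)
    show "(F has_vector_derivative (p s - p (s * r)) / s) (at s)" if "0 < ereal s" for s
      using F' that by (simp add: has_real_derivative_iff_has_vector_derivative)
    show "isCont (\<lambda>s. (p s - p (s * r)) / s) s" if "0 < ereal s" for s
      using that r by (auto intro!: continuous_intros isc isCont_o2 [OF _ isc])
    show "set_integrable lborel (einterval 0 \<infinity>) (\<lambda>s. (p s - p (s * r)) / s)"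
      using int by (simp add: einterval_def greaterThan_def)
    have "((\<lambda>s. F s + p 0 * ln r) \<longlongrightarrow> 0) (at_right 0)"
    proof (rule Lim_null_comparison)
      show "eventually (\<lambda>s. norm (F s + p 0 * ln r) \<le> C * \<bar>s - s * r\<bar>) (at_right 0)"
      proof (rule eventually_at_rightI [of 0 1])
        fix s :: real assume "s \<in> {0<..<1}"
        then have s: "0 < s" by simp
        have "\<bar>(L s - p 0 * ln s) - (L (s * r) - p 0 * ln (s * r))\<bar> \<le> C * \<bar>s - s * r\<bar>"
        proof (rule has_real_derivative_imp_diff_bound)
          fix u assume "u \<in> closed_segment s (s * r)"
          then have u: "0 < u" using pos s by blast
          show "((\<lambda>s. L s - p 0 * ln s) has_real_derivative (p u - p 0) / u) (at u)"
            using u by (auto intro!: derivative_eq_intros L simp: diff_divide_distrib)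
          show "\<bar>(p u - p 0) / u\<bar> \<le> C"
            using lip [OF u] u by (simp add: divide_le_eq)
        qed
        then show "norm (F s + p 0 * ln r) \<le> C * \<bar>s - s * r\<bar>"
          using s r by (simp add: F_def ln_mult algebra_simps)
      qed simp
      show "((\<lambda>s. C * \<bar>s - s * r\<bar>) \<longlongrightarrow> 0) (at_right 0)"
        by (rule tendsto_eq_intros | simp)+
    qed
    then have "(F \<longlongrightarrow> - p 0 * ln r) (at_right 0)"
      by (drule_tac tendsto_diff [OF _ tendsto_const [of "p 0 * ln r"]]) simp
    then show "((F \<circ> real_of_ereal) \<longlongrightarrow> - p 0 * ln r) (at_right 0)"
      by (simp add: zero_ereal_def ereal_tendsto_simps)
    have "(F \<longlongrightarrow> 0) at_top"
    proof (rule Lim_null_comparison)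
      show "eventually (\<lambda>s. norm (F s) \<le> C * \<bar>1 - r\<bar> / (min 1 r)\<^sup>2 / s) at_top"
        using eventually_gt_at_top [of 0]
      proof eventually_elim
        case (elim s)
        have C: "0 \<le> C" using lip [of 1] by (smt (verit))
        \<comment> \<open>Every u between s and s r is at least s min(1, r), which bounds |p(u) /
          u|. The segment has length s |1 - r|, so the product is of order 1 / s.\<close>
        have "\<bar>L s - L (s * r)\<bar> \<le> C / (s * min 1 r)\<^sup>2 * \<bar>s - s * r\<bar>"
        proof (rule has_real_derivative_imp_diff_bound)
          fix u assume u: "u \<in> closed_segment s (s * r)"
          show "(L has_real_derivative p u / u) (at u)"
            using pos [OF u elim] L by blast
          have "\<bar>p u / u\<bar> \<le> C / u / u"
            using divide_right_mono [OF decay [of u], of u] pos [OF u elim] by simp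
          also have "\<dots> = C / u\<^sup>2" by (simp add: power2_eq_square)
          also have "\<dots> \<le> C / (s * min 1 r)\<^sup>2"
            using pos [OF u elim] C elim r
            by (intro divide_left_mono power_mono mult_pos_pos zero_less_power)
              (auto simp: min_mult_distrib_left min_def split: if_splits)
          finally show "\<bar>p u / u\<bar> \<le> C / (s * min 1 r)\<^sup>2" .
        qed
        also have "\<bar>s - s * r\<bar> = s * \<bar>1 - r\<bar>"
          using elim abs_mult [of s "1 - r"] by (simp add: algebra_simps)
        also have "C / (s * min 1 r)\<^sup>2 * (s * \<bar>1 - r\<bar>) = C * \<bar>1 - r\<bar> / (min 1 r)\<^sup>2 / s"
          using elim by (simp add: power2_eq_square)
        finally show ?case by (simp add: F_def)
      qed
      show "((\<lambda>s. C * \<bar>1 - r\<bar> / (min 1 r)\<^sup>2 / s) \<longlongrightarrow> 0) at_top"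
        by (intro tendsto_divide_0 [OF tendsto_const]) (simp add: filterlim_ident filterlim_at_top_imp_at_infinity)
    qed
    then show "((F \<circ> real_of_ereal) \<longlongrightarrow> 0) (at_left \<infinity>)"
      by (simp add: ereal_tendsto_simps)
  qed simp
  then show ?thesis
    by (simp add: interval_lebesgue_integral_def einterval_def greaterThan_def)
qed


text \<open>The scalar core of injectivity: \<open>p s\<close> and \<open>g s t\<close> stand for a
  functional applied to R(s) x and R(s) R(t) x. Keeping \<open>g\<close> as a function of its own
  supplies a continuous value on the diagonal, where the divided difference is undefined.\<close>

lemma power_weighted_divided_difference_zero:
  fixes p :: "real \<Rightarrow> real" and g :: "real \<Rightarrow> real \<Rightarrow> real"
  assumes a: "0 < a" "a < 1"
    and p_cont: "continuous_on {0..} p"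
    and lip: "\<And>s. 0 < s \<Longrightarrow> \<bar>p s - p 0\<bar> \<le> C * s"
    and decay: "\<And>s. 0 < s \<Longrightarrow> \<bar>p s\<bar> \<le> C / s"
    and quot: "\<And>s t. 0 < s \<Longrightarrow> 0 < t \<Longrightarrow> p s - p t = (t - s) * g s t"
    and g_cont: "continuous_on ({0<..} \<times> {0<..}) (\<lambda>(s, t). g s t)"
    and g_bound: "\<And>s t. 0 < s \<Longrightarrow> 0 < t \<Longrightarrow> \<bar>g s t\<bar> \<le> C / ((1 + s) * (1 + t))"
    and zero: "\<And>s. 0 < s \<Longrightarrow> integral {0<..} (\<lambda>t. t powr - a * g s t) = 0"
  shows "p 0 = 0"
proof -
  define H where "H s r = indicator ({0<..} \<times> {0<..}) (s, r) * (r powr - a * g s (s * r))" for s r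
  have C: "0 \<le> C" using lip [of 1] by (smt (verit))
  let ?b = "powr_pieces (1 - a / 2) (1 + (1 - a) / 2)"
  let ?c = "powr_pieces ((1 + a) / 2) (1 + a / 2)"
  have b: "integrable lborel ?b" and c: "integrable lborel ?c"
    using a by (auto intro!: powr_pieces_integrable)
  have H_meas: "case_prod H \<in> borel_measurable (lborel \<Otimes>\<^sub>M lborel)"
  proof -
    have "continuous_on ({0<..} \<times> {0<..}) (\<lambda>x. (\<lambda>(s, t). g s t) (fst x, fst x * snd x))"
      by (rule continuous_on_compose2 [OF g_cont]) (auto intro!: continuous_intros)
    then have "continuous_on ({0<..} \<times> {0<..}) (\<lambda>x. snd x powr - a * g (fst x) (fst x * snd x))"
      by (auto intro!: continuous_intros)
    then have "(\<lambda>x. indicator ({0<..} \<times> {0<..}) x *\<^sub>R (snd x powr - a * g (fst x) (fst x * snd x)))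
        \<in> borel_measurable borel"
      by (intro borel_measurable_continuous_on_indicator) (auto intro!: borel_open open_Times)
    moreover have "borel_measurable (lborel \<Otimes>\<^sub>M lborel) =
        (borel_measurable borel :: (real \<times> real \<Rightarrow> real) set)"
      by (intro measurable_cong_sets) (simp_all only: lborel_prod sets_lborel)
    ultimately show ?thesis
      by (simp add: H_def [abs_def] case_prod_beta')
  qed
  have H_le: "\<bar>H s r\<bar> \<le> C * (?b s * ?c r)" for s r
  proof (cases "0 < s \<and> 0 < r")
    case True
    then have "\<bar>H s r\<bar> = r powr - a * \<bar>g s (s * r)\<bar>"
      by (simp add: H_def abs_mult)
    also have "\<dots> \<le> r powr - a * (C / ((1 + s) * (1 + s * r)))"
      using True by (intro mult_left_mono g_bound) auto
    also have "\<dots> = C * (r powr - a / ((1 + s) * (1 + s * r)))" by simp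
    also have "\<dots> \<le> C * (?b s * ?c r)"
      using True a C by (intro mult_left_mono dilation_kernel_le) auto
    finally show ?thesis .
  next
    case False
    then show ?thesis using C by (auto simp: H_def powr_pieces_nonneg)
  qed
  have dom: "integrable (lborel \<Otimes>\<^sub>M lborel) (\<lambda>(s, r). C * (?b s * ?c r))"
  proof (rule lborel_pair.Fubini_integrable)
    show "integrable lborel (\<lambda>s. LBINT r. norm (case (s, r) of (s, r) \<Rightarrow> C * (?b s * ?c r)))"
      using b by (simp add: abs_mult powr_pieces_nonneg)
    show "AE s in lborel. integrable lborel (\<lambda>r. case (s, r) of (s, r) \<Rightarrow> C * (?b s * ?c r))"
      using c by simp
  qed measurable
  have H_int: "integrable (lborel \<Otimes>\<^sub>M lborel) (case_prod H)"
    using H_le by (intro Bochner_Integration.integrable_bound [OF dom H_meas] AE_I2)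
      (auto intro: order_trans [OF _ abs_ge_self])
  have H_meas1: "(\<lambda>r. H s r) \<in> borel_measurable lborel" for s
    using measurable_compose [OF measurable_Pair1' H_meas, of s] by simp
  have H_meas2: "(\<lambda>s. H s r) \<in> borel_measurable lborel" for r
    using measurable_compose [OF measurable_Pair2' H_meas, of r] by simp
  have H_int1: "integrable lborel (\<lambda>r. H s r)" for s
    using H_le
    by (intro Bochner_Integration.integrable_bound [OF _ H_meas1, of "\<lambda>r. C * (?b s * ?c r)"] AE_I2)
      (auto intro: order_trans [OF _ abs_ge_self] c)
  have H_int2: "integrable lborel (\<lambda>s. H s r)" for r
    using H_le
    by (intro Bochner_Integration.integrable_bound [OF _ H_meas2, of "\<lambda>s. C * (?b s * ?c r)"] AE_I2)
      (auto intro: order_trans [OF _ abs_ge_self] b)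
  have inner1: "(LBINT r. H s r) = 0" for s
  proof (cases "0 < s")
    case True
    let ?f = "\<lambda>t. indicator {0<..} t * (t powr - a * g s t)"
    have eq: "?f (0 + s * r) = s powr - a * H s r" for r
      using True by (auto simp: H_def indicator_def zero_less_mult_iff powr_mult)
    \<comment> \<open>The hypothesis \<open>zero\<close> is about the gauge integral, which is 0 by
      default for a non-integrable function. To read it as a Lebesgue integral, integrability of
      \<open>?f\<close> is carried over from \<open>H s\<close> by the dilation t = s r.\<close>
    have "integrable lborel (\<lambda>r. ?f (0 + s * r))"
      unfolding eq using H_int1 by simp
    then have f: "integrable lborel ?f"
      using True lborel_integrable_real_affine_iff [of s ?f 0] by simp
    then have "(LBINT t. ?f t) = 0"
      using zero [OF True] set_borel_integral_eq_integral(2) [of "{0<..}" "\<lambda>t. t powr - a * g s t"]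
      by (simp add: set_integrable_def set_lebesgue_integral_def)
    then have "s * (LBINT r. s powr - a * H s r) = 0"
      using lborel_integral_real_affine [of s ?f 0] True unfolding eq by simp
    then show ?thesis
      using True by simp
  qed (simp add: H_def)
  have inner2: "(LBINT s. H s r) = indicator {0<..} r * (r powr - a * (p 0 * (ln r / (r - 1))))"
    if "r \<noteq> 1" for r
  proof (cases "0 < r")
    case True
    \<comment> \<open>For t = s r the factor t - s is s (r - 1), and its s cancels the denominator
      of the Frullani integrand.\<close>
    have eq: "indicator {0<..} s *\<^sub>R ((p s - p (s * r)) / s) = (r - 1) * r powr a * H s r" for s
    proof (cases "0 < s")
      case s: True
      have "(p s - p (s * r)) / s = (r - 1) * g s (s * r)"
        using quot [of s "s * r"] s True by (simp add: field_simps)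
      then show ?thesis using s True by (simp add: H_def powr_minus)
    qed (simp add: H_def)
    have "set_lebesgue_integral lborel {0<..} (\<lambda>s. (p s - p (s * r)) / s) = p 0 * ln r"
    proof (rule frullani_integral [OF True p_cont lip decay])
      show "set_integrable lborel {0<..} (\<lambda>s. (p s - p (s * r)) / s)"
        unfolding set_integrable_def eq using H_int2 by simp
    qed
    then have "(r - 1) * r powr a * (LBINT s. H s r) = p 0 * ln r"
      unfolding set_lebesgue_integral_def eq by simp
    then show ?thesis
      using True that by (simp add: powr_minus field_simps)
  qed (simp add: H_def)
  \<comment> \<open>The value at r = 1 affects only a null set. For other r > 0 the numbers ln r and
    r - 1 have the same sign, so W is positive there.\<close>
  define W :: "real \<Rightarrow> real" where
    "W r = (if 0 < r \<and> r \<noteq> 1 then r powr - a * (ln r / (r - 1)) else 0)" for r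
  have "AE r in lborel. r \<noteq> (1::real)"
    by (rule AE_lborel_singleton)
  then have inner2': "AE r in lborel. (LBINT s. H s r) = p 0 * W r"
    by eventually_elim (auto simp: inner2 W_def)
  have W_pos: "0 < W r" if "0 < r" "r \<noteq> 1" for r
  proof -
    have "0 < ln r / (r - 1)"
      using that by (simp add: zero_less_divide_iff) linarith
    then have "0 < r powr - a * (ln r / (r - 1))"
      using that by (intro mult_pos_pos) auto
    then show ?thesis using that by (simp add: W_def)
  qed
  then have W_nonneg: "0 \<le> W r" for r
    by (cases "0 < r \<and> r \<noteq> 1") (auto simp: W_def intro: less_imp_le)
  have "(LBINT r. LBINT s. H s r) = (LBINT s. LBINT r. H s r)"
    by (rule lborel_pair.Fubini_integral [OF H_int])
  then have "(LBINT r. LBINT s. H s r) = 0"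
    by (simp add: inner1)
  moreover have "integrable lborel (\<lambda>r. LBINT s. H s r)"
    by (rule lborel_pair.integrable_snd [OF H_int])
  moreover have [measurable]: "W \<in> borel_measurable lborel"
    unfolding W_def [abs_def] by measurable
  ultimately have int: "integrable lborel (\<lambda>r. p 0 * W r)" and "(LBINT r. p 0 * W r) = 0"
    using integral_cong_AE [OF _ _ inner2'] integrable_cong_AE [OF _ _ inner2']
    by (auto dest: borel_measurable_integrable)
  show ?thesis
  proof (rule ccontr)
    assume p0: "p 0 \<noteq> 0"
    then have "integrable lborel W" "(LBINT r. W r) = 0"
      using int \<open>(LBINT r. p 0 * W r) = 0\<close> by auto
    then have "AE r in lborel. W r = 0"
      using integral_nonneg_eq_0_iff_AE [of lborel W] W_nonneg by auto
    \<comment> \<open>W is positive on (0, 1), so its vanishing almost everywhere would make this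
      interval a null set.\<close>
    then have "AE r in lborel. r \<notin> {0<..<(1::real)}"
      by eventually_elim (use W_pos in force)
    then have "emeasure lborel {0<..<(1::real)} = 0"
      by (subst (asm) AE_iff_measurable [of "{0<..<1}"]) auto
    then show False by simp
  qed
qed

section \<open>Negative powers of a resolvent family\<close>

locale resolvent_family =
  fixes R :: "real \<Rightarrow> 'a::banach \<Rightarrow>\<^sub>L 'a" and M :: real
  assumes norm_le: "0 \<le> t \<Longrightarrow> norm (R t) \<le> M / (1 + t)"
    and resolvent_identity: "0 \<le> s \<Longrightarrow> 0 \<le> t \<Longrightarrow> R s - R t = (t - s) *\<^sub>R (R s o\<^sub>L R t)"
begin

lemma M_nonneg: "0 \<le> M"
  using order_trans [OF norm_ge_zero norm_le [of 0]] by simp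

lemma norm_le_M:
  assumes "0 \<le> t"
  shows "norm (R t) \<le> M"
proof -
  have "M / (1 + t) \<le> M / 1"
    using assms M_nonneg by (intro divide_left_mono) auto
  then show ?thesis using norm_le [OF assms] by simp
qed

text \<open>Exchanging s and t in the resolvent identity changes the sign of the left side and of
  the scalar factor, hence leaves the composition unchanged when s and t differ.\<close>

lemma commute:
  assumes "0 \<le> s" "0 \<le> t"
  shows "R s o\<^sub>L R t = R t o\<^sub>L R s"
proof (cases "s = t")
  case False
  have "(t - s) *\<^sub>R (R s o\<^sub>L R t) = - ((s - t) *\<^sub>R (R t o\<^sub>L R s))"
    using assms by (metis minus_diff_eq resolvent_identity)
  also have "\<dots> = (t - s) *\<^sub>R (R t o\<^sub>L R s)"
    by (simp flip: scaleR_minus_left)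
  finally show ?thesis using False by simp
qed simp

lemma norm_compose_le:
  assumes "0 \<le> s" "0 \<le> t"
  shows "norm (R s o\<^sub>L R t) \<le> M\<^sup>2 / ((1 + s) * (1 + t))"
proof -
  have "norm (R s o\<^sub>L R t) \<le> norm (R s) * norm (R t)" by (rule norm_blinfun_compose)
  also have "\<dots> \<le> M / (1 + s) * (M / (1 + t))"
    using assms norm_le M_nonneg by (intro mult_mono) auto
  finally show ?thesis by (simp add: power2_eq_square)
qed

lemma lipschitz:
  assumes "0 \<le> s" "0 \<le> t"
  shows "norm (R s - R t) \<le> M\<^sup>2 * \<bar>s - t\<bar>"
proof -
  have "norm (R s o\<^sub>L R t) \<le> M * M"
    using norm_le_M assms M_nonneg by (intro order_trans [OF norm_blinfun_compose] mult_mono) auto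
  then show ?thesis
    using resolvent_identity [OF assms] mult_left_mono [of "norm (R s o\<^sub>L R t)" "M * M" "\<bar>t - s\<bar>"]
    by (simp add: power2_eq_square abs_minus_commute mult.commute)
qed

lemma continuous_on_R: "continuous_on {0..} R"
proof (rule continuous_onI)
  fix s e :: real assume s: "s \<in> {0..}" and e: "0 < e"
  have "dist (R t) (R s) \<le> e" if "t \<in> {0..}" "dist t s < e / (M\<^sup>2 + 1)" for t
  proof -
    have "dist (R t) (R s) \<le> M\<^sup>2 * \<bar>t - s\<bar>"
      using lipschitz [of t s] s that by (simp add: dist_norm)
    also have "\<dots> \<le> (M\<^sup>2 + 1) * \<bar>t - s\<bar>" by (simp add: distrib_right)
    also have "\<dots> \<le> e"
      using that by (simp add: dist_real_def pos_less_divide_eq add_pos_nonneg add_nonneg_pos mult.commute)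
    finally show ?thesis .
  qed
  then show "\<exists>d>0. \<forall>t\<in>{0..}. dist t s < d \<longrightarrow> dist (R t) (R s) \<le> e"
    using e by (intro exI [of _ "e / (M\<^sup>2 + 1)"]) (auto intro!: divide_pos_pos add_nonneg_pos)
qed

lemma continuous_on_R_compose [continuous_intros]:
  "continuous_on S f \<Longrightarrow> (\<And>x. x \<in> S \<Longrightarrow> 0 \<le> f x) \<Longrightarrow> continuous_on S (\<lambda>x. R (f x))"
  by (rule continuous_on_compose2 [OF continuous_on_R]) auto

text \<open>By the resolvent identity the remainder of the linear approximation is exactly (t - s)
  (R(s) - R(t)) R(t), and R is Lipschitz.\<close>

lemma has_vector_derivative_R:
  assumes "0 < t"
  shows "(R has_vector_derivative - (R t o\<^sub>L R t)) (at t)"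
  unfolding has_vector_derivative_def
proof (rule has_derivativeI_sandwich [of t, where H = "\<lambda>s. M\<^sup>2 * \<bar>s - t\<bar> * M"])
  fix s assume s: "s \<noteq> t" "dist s t < t"
  then have "0 \<le> s" by (simp add: dist_real_def)
  have "R s - R t - (s - t) *\<^sub>R - (R t o\<^sub>L R t) = (t - s) *\<^sub>R ((R s - R t) o\<^sub>L R t)"
    using resolvent_identity [of s t] \<open>0 \<le> s\<close> assms
    by (simp add: bounded_bilinear.diff_left [OF bounded_bilinear_blinfun_compose] algebra_simps)
  then have "norm (R s - R t - (s - t) *\<^sub>R - (R t o\<^sub>L R t)) / norm (s - t) = norm ((R s - R t) o\<^sub>L R t)"
    using s by (simp add: abs_minus_commute)
  also have "\<dots> \<le> norm (R s - R t) * norm (R t)" by (rule norm_blinfun_compose)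
  also have "\<dots> \<le> M\<^sup>2 * \<bar>s - t\<bar> * M"
    using lipschitz norm_le_M \<open>0 \<le> s\<close> assms by (intro mult_mono) auto
  finally show "norm (R s - R t - (s - t) *\<^sub>R - (R t o\<^sub>L R t)) / norm (s - t) \<le> M\<^sup>2 * \<bar>s - t\<bar> * M" .
next
  show "((\<lambda>s. M\<^sup>2 * \<bar>s - t\<bar> * M) \<longlongrightarrow> 0) (at t)"
    by (rule tendsto_eq_intros | simp)+
qed (use assms in \<open>auto intro!: bounded_linear_minus bounded_linear_scaleR_left\<close>)

text \<open>The singularity of the weight at the origin is removed by integrating by parts, since
  dominated convergence is not available for integrals with values in a Banach space.\<close>

lemma integrable_powr_R_from_0:
  assumes "0 < a" "a < 1" "0 \<le> c"
  shows "(\<lambda>t. t powr - a *\<^sub>R R t) integrable_on {0..c}"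
proof -
  \<comment> \<open>The primitive t^(1 - a) / (1 - a) R(t) is continuous up to 0 and is
    differentiated only in the interior. The second term of its derivative is continuous on the
    closed interval, so it can be added back.\<close>
  have "((\<lambda>t. t powr - a *\<^sub>R R t - (t powr (1 - a) / (1 - a)) *\<^sub>R (R t o\<^sub>L R t)) has_integral
      (c powr (1 - a) / (1 - a)) *\<^sub>R R c - (0 powr (1 - a) / (1 - a)) *\<^sub>R R 0) {0..c}"
  proof (rule fundamental_theorem_of_calculus_interior)
    show "continuous_on {0..c} (\<lambda>t. (t powr (1 - a) / (1 - a)) *\<^sub>R R t)"
      using assms by (intro continuous_intros continuous_on_powr') auto
    fix t assume t: "t \<in> {0<..<c}"
    have "((\<lambda>t. t powr (1 - a) / (1 - a)) has_real_derivative t powr - a) (at t)"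
      using t assms by (auto intro!: derivative_eq_intros)
    then have "((\<lambda>t. (t powr (1 - a) / (1 - a)) *\<^sub>R R t) has_vector_derivative
        (t powr (1 - a) / (1 - a)) *\<^sub>R - (R t o\<^sub>L R t) + t powr - a *\<^sub>R R t) (at t)"
      using t by (intro has_vector_derivative_scaleR has_vector_derivative_R) auto
    then show "((\<lambda>t. (t powr (1 - a) / (1 - a)) *\<^sub>R R t) has_vector_derivative
        t powr - a *\<^sub>R R t - (t powr (1 - a) / (1 - a)) *\<^sub>R (R t o\<^sub>L R t)) (at t)"
      by simp
  qed (use assms in auto)
  moreover have "(\<lambda>t. (t powr (1 - a) / (1 - a)) *\<^sub>R (R t o\<^sub>L R t)) integrable_on {0..c}"
    using assms by (intro integrable_continuous_interval continuous_intros continuous_on_powr'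
      bounded_bilinear.continuous_on [OF bounded_bilinear_blinfun_compose]) auto
  ultimately have "(\<lambda>t. (t powr - a *\<^sub>R R t - (t powr (1 - a) / (1 - a)) *\<^sub>R (R t o\<^sub>L R t))
      + (t powr (1 - a) / (1 - a)) *\<^sub>R (R t o\<^sub>L R t)) integrable_on {0..c}"
    by (rule integrable_add [OF has_integral_integrable])
  then show ?thesis by simp
qed

text \<open>Extended by zero, the integrand is integrable on every compact interval, and its norm
  lies below an integrable scalar function.\<close>

lemma integrable_powr_R:
  assumes "0 < a" "a < 1"
  shows "(\<lambda>t. t powr - a *\<^sub>R R t) integrable_on {0<..}"
proof -
  let ?f = "\<lambda>t. if t \<in> {0<..} then t powr - a *\<^sub>R R t else 0"
  have "?f integrable_on UNIV"
  proof (rule integrable_on_all_intervals_UNIV)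
    show "?f integrable_on cbox x y" for x y :: real
    proof -
      have "?f integrable_on {0..max y 0}"
        by (rule integrable_spike_finite [of "{0}", OF _ _ integrable_powr_R_from_0 [OF assms]]) auto
      moreover have "?f integrable_on {x..0}"
        by (rule integrable_eq [OF integrable_0]) auto
      ultimately have "?f integrable_on ({x..0} \<union> {0..max y 0})"
        by (intro integrable_Un) (auto intro: negligible_subset [of "{0}"])
      then show ?thesis
        by (rule integrable_on_subcbox [of _ "{x..0} \<union> {0..max y 0}"]) auto
    qed
    show "norm (?f t) \<le> M * powr_pieces a (1 + a) t" for t
    proof (cases "0 < t")
      case True
      have "norm (?f t) \<le> t powr - a * (M / (1 + t))"
        using True mult_left_mono [OF norm_le [of t], of "t powr - a"] by simp
      also have "\<dots> = M * (t powr - a / (1 + t))" by simp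
      also have "\<dots> \<le> M * powr_pieces a (1 + a) t"
        using True assms M_nonneg by (intro mult_left_mono powr_over_one_plus_le) auto
      finally show ?thesis .
    qed (use M_nonneg in \<open>simp add: powr_pieces_nonneg\<close>)
    show "(\<lambda>t. M * powr_pieces a (1 + a) t) integrable_on UNIV"
      using powr_pieces_integrable_on [of a "1 + a"] assms by (simp add: integrable_on_mult_right)
  qed
  then show ?thesis by (simp only: integrable_restrict_UNIV)
qed

section \<open>Balakrishnan's negative powers: commutation and injectivity\<close>

definition neg_pow :: "real \<Rightarrow> 'a \<Rightarrow>\<^sub>L 'a" where
  "neg_pow a = (sin (pi * a) / pi) *\<^sub>R integral {0<..} (\<lambda>t. t powr - a *\<^sub>R R t)"

text \<open>The integral is taken in the space of bounded operators, so a single interchange rule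
  covers evaluation at a vector and composition from the left and from the right.\<close>

lemma neg_pow_linear_functional:
  assumes "0 < a" "a < 1" "bounded_linear h"
  shows "h (neg_pow a) = (sin (pi * a) / pi) *\<^sub>R integral {0<..} (\<lambda>t. t powr - a *\<^sub>R h (R t))"
proof -
  interpret h: bounded_linear h by fact
  show ?thesis
    using integral_linear [OF integrable_powr_R [OF assms(1,2)] assms(3)]
    by (simp add: neg_pow_def h.scaleR o_def)
qed

lemma neg_pow_apply:
  assumes "0 < a" "a < 1"
  shows "neg_pow a x = (sin (pi * a) / pi) *\<^sub>R integral {0<..} (\<lambda>t. t powr - a *\<^sub>R R t x)"
  using assms by (rule neg_pow_linear_functional) (rule blinfun.bounded_linear_left)

lemma neg_pow_commute_of_commute:
  assumes "0 < a" "a < 1" "\<And>t. 0 < t \<Longrightarrow> T o\<^sub>L R t = R t o\<^sub>L T"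
  shows "T o\<^sub>L neg_pow a = neg_pow a o\<^sub>L T"
proof -
  have "T o\<^sub>L neg_pow a = (sin (pi * a) / pi) *\<^sub>R integral {0<..} (\<lambda>t. t powr - a *\<^sub>R (T o\<^sub>L R t))"
    using assms(1,2)
    by (rule neg_pow_linear_functional) (rule bounded_bilinear.bounded_linear_right [OF bounded_bilinear_blinfun_compose])
  also have "\<dots> = (sin (pi * a) / pi) *\<^sub>R integral {0<..} (\<lambda>t. t powr - a *\<^sub>R (R t o\<^sub>L T))"
    using assms(3) by (intro arg_cong [where f = "scaleR _"] Henstock_Kurzweil_Integration.integral_cong) simp
  also have "\<dots> = neg_pow a o\<^sub>L T"
    using assms(1,2)
    by (rule neg_pow_linear_functional [symmetric]) (rule bounded_bilinear.bounded_linear_left [OF bounded_bilinear_blinfun_compose])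
  finally show ?thesis .
qed

lemma R_neg_pow_commute:
  assumes "0 < a" "a < 1" "0 \<le> t"
  shows "R t o\<^sub>L neg_pow a = neg_pow a o\<^sub>L R t"
  using assms(1,2) by (rule neg_pow_commute_of_commute) (use assms in \<open>auto intro: commute\<close>)

lemma neg_pow_neg_pow_commute:
  assumes "0 < a" "a < 1" "0 < b" "b < 1"
  shows "neg_pow a o\<^sub>L neg_pow b = neg_pow b o\<^sub>L neg_pow a"
  using assms(3,4) by (rule neg_pow_commute_of_commute) (use assms in \<open>auto intro: R_neg_pow_commute [symmetric]\<close>)

text \<open>This is the scalar lemma for p(s) = h (R(s) x), whose divided differences the resolvent
  identity supplies. Working with one real functional at a time keeps the Fubini argument in
  real-valued Lebesgue integration.\<close>

lemma functional_R_0_eq_0: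
  assumes a: "0 < a" "a < 1" and x: "neg_pow a x = 0" and h: "bounded_linear (h :: 'a \<Rightarrow> real)"
  shows "h (R 0 x) = 0"
proof -
  interpret h: bounded_linear h by fact
  obtain K where K: "0 \<le> K" "\<And>y. norm (h y) \<le> norm y * K"
    using h.nonneg_bounded by auto
  \<comment> \<open>The decay of p costs M, its Lipschitz estimate and the bound on \<open>g\<close>
    cost M^2; the scalar lemma asks for one constant.\<close>
  define C where "C = max M (M\<^sup>2) * norm x * K"
  have h_le: "\<bar>h (T x)\<bar> \<le> c * norm x * K" if "norm T \<le> c" for T :: "'a \<Rightarrow>\<^sub>L 'a" and c
  proof -
    have "\<bar>h (T x)\<bar> \<le> norm (T x) * K" using K(2) [of "T x"] by simp
    also have "\<dots> \<le> c * norm x * K"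
      using K(1) order_trans [OF norm_blinfun [of T x] mult_right_mono [OF that norm_ge_zero]]
      by (intro mult_right_mono)
    finally show ?thesis .
  qed
  have C: "M * norm x * K \<le> C" "M\<^sup>2 * norm x * K \<le> C"
    unfolding C_def using K(1) by (auto intro!: mult_right_mono)
  show ?thesis
  proof (rule power_weighted_divided_difference_zero [OF a, where p = "\<lambda>s. h (R s x)" and
      g = "\<lambda>s t. h ((R s o\<^sub>L R t) x)" and C = C])
    show "continuous_on {0..} (\<lambda>s. h (R s x))"
      by (intro h.continuous_on blinfun.continuous_on continuous_intros) auto
    fix s :: real assume s: "0 < s"
    have "\<bar>h ((R s - R 0) x)\<bar> \<le> (M\<^sup>2 * s) * norm x * K"
      using lipschitz [of s 0] s by (intro h_le) simp
    also have "\<dots> \<le> C * s"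
      using mult_right_mono [OF C(2), of s] s by (simp add: mult_ac)
    finally show "\<bar>h (R s x) - h (R 0 x)\<bar> \<le> C * s"
      by (simp add: blinfun.diff_left h.diff)
    have "\<bar>h (R s x)\<bar> \<le> (M / (1 + s)) * norm x * K"
      using norm_le s by (intro h_le) simp
    also have "\<dots> = M * norm x * K / (1 + s)" by simp
    also have "\<dots> \<le> C / s"
      using C(1) s K(1) M_nonneg by (intro frac_le order_trans [OF _ C(1)]) auto
    finally show "\<bar>h (R s x)\<bar> \<le> C / s" .
    \<comment> \<open>The factor sin (pi a) is nonzero for 0 < a < 1, so the vector integral itself
      vanishes; applying h after R(s) then gives a zero integral for every s.\<close>
    have "integral {0<..} (\<lambda>t. t powr - a *\<^sub>R R t x) = 0"
      using neg_pow_apply [OF a, of x] x sin_gt_zero [of "pi * a"] a by simp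
    moreover have "(\<lambda>t. t powr - a *\<^sub>R R t x) integrable_on {0<..}"
      using integrable_linear [OF integrable_powr_R [OF a] blinfun.bounded_linear_left [of x]]
      by (simp add: o_def blinfun.scaleR_left)
    moreover have "bounded_linear (\<lambda>y. h (R s y))"
      using h.bounded_linear_axioms by (rule bounded_linear_compose) (rule blinfun.bounded_linear_right)
    ultimately show "integral {0<..} (\<lambda>t. t powr - a * h ((R s o\<^sub>L R t) x)) = 0"
      using integral_linear [of "\<lambda>t. t powr - a *\<^sub>R R t x" "{0<..}" "\<lambda>y. h (R s y)"]
      by (simp add: o_def blinfun.scaleR_right h.scaleR blinfun.zero_right)
  next
    fix s t :: real assume st: "0 < s" "0 < t"
    have "h ((R s - R t) x) = (t - s) * h ((R s o\<^sub>L R t) x)"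
      using resolvent_identity [of s t] st by (simp add: blinfun.scaleR_left h.scaleR)
    then show "h (R s x) - h (R t x) = (t - s) * h ((R s o\<^sub>L R t) x)"
      by (simp add: blinfun.diff_left h.diff)
    have "\<bar>h ((R s o\<^sub>L R t) x)\<bar> \<le> (M\<^sup>2 / ((1 + s) * (1 + t))) * norm x * K"
      using norm_compose_le st by (intro h_le) simp
    also have "\<dots> = M\<^sup>2 * norm x * K / ((1 + s) * (1 + t))" by simp
    also have "\<dots> \<le> C / ((1 + s) * (1 + t))"
      using C(2) st by (intro divide_right_mono) auto
    finally show "\<bar>h ((R s o\<^sub>L R t) x)\<bar> \<le> C / ((1 + s) * (1 + t))" .
  next
    show "continuous_on ({0<..} \<times> {0<..}) (\<lambda>(s, t). h ((R s o\<^sub>L R t) x))"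
      unfolding case_prod_beta
      by (simp, intro h.continuous_on blinfun.continuous_on continuous_intros) auto
  qed
qed

end

section \<open>Sectorial operators\<close>

instance chilbert_space \<subseteq> banach ..

section \<open>Real-part estimates for the complex inner product\<close>

lemma cinner_zero_left [simp]: "cinner 0 (x :: 'a::complex_inner) = 0"
  using cinner_add_left [of 0 0 x] by simp

lemma cinner_zero_right [simp]: "cinner (x :: 'a::complex_inner) 0 = 0"
  by (subst cinner_commute) simp

lemma cinner_diff_left: "cinner (x - y) z = cinner x z - cinner y (z :: 'a::complex_inner)"
  using cinner_add_left [of "x - y" y z] by simp

lemma cinner_scaleR_left: "cinner (r *\<^sub>R x) y = of_real r * cinner x (y :: 'a::complex_inner)"
  by (simp add: scaleR_scaleC cinner_scaleC_left)

lemma Re_cinner_self: "Re (cinner x (x :: 'a::complex_inner)) = (norm x)\<^sup>2"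
  using cinner_real_nonneg [of x] by (simp add: norm_eq_sqrt_cinner)

lemma Re_cinner_commute: "Re (cinner x y) = Re (cinner y (x :: 'a::complex_inner))"
  by (subst cinner_commute) simp

text \<open>Cauchy-Schwarz is recovered from the triangle inequality, already available for the
  norm, by expanding the square of the norm of y + z.\<close>

lemma abs_Re_cinner_le: "\<bar>Re (cinner x y)\<bar> \<le> norm x * norm (y :: 'a::complex_inner)"
proof -
  have le: "Re (cinner z y) \<le> norm z * norm y" for z
  proof -
    have "(norm (y + z))\<^sup>2 = Re (cinner y (y + z)) + Re (cinner z (y + z))"
      by (simp flip: Re_cinner_self add: cinner_add_left)
    also have "\<dots> = (norm y)\<^sup>2 + 2 * Re (cinner z y) + (norm z)\<^sup>2"
      using Re_cinner_commute [of y "y + z"] Re_cinner_commute [of z "y + z"] Re_cinner_commute [of y z]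
      by (simp add: cinner_add_left Re_cinner_self)
    finally have "(norm y)\<^sup>2 + 2 * Re (cinner z y) + (norm z)\<^sup>2 \<le> (norm y + norm z)\<^sup>2"
      using power_mono [OF norm_triangle_ineq [of y z], of 2] by simp
    then show ?thesis by (simp add: power2_sum mult.commute)
  qed
  show ?thesis
    using le [of x] le [of "- x"] cinner_diff_left [of 0 x y] by auto
qed

lemma bounded_linear_Re_cinner: "bounded_linear (\<lambda>y. Re (cinner y (x :: 'a::complex_inner)))"
  by (rule bounded_linear_intro [of _ "norm x"])
    (auto simp: cinner_add_left cinner_scaleR_left abs_Re_cinner_le)

section \<open>The resolvent of a sectorial operator along the negative half-line\<close>

lemma locally_bounded_imp_bounded_on_compact:
  fixes f :: "'a::metric_space \<Rightarrow> real"
  assumes "compact S" and "\<And>x. x \<in> S \<Longrightarrow> \<exists>e>0. \<exists>B. \<forall>y\<in>S. dist x y < e \<longrightarrow> f y \<le> B"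
  shows "\<exists>B. \<forall>y\<in>S. f y \<le> B"
proof -
  obtain e B where e: "\<And>x. x \<in> S \<Longrightarrow> 0 < e x"
    and B: "\<And>x y. x \<in> S \<Longrightarrow> y \<in> S \<Longrightarrow> dist x y < e x \<Longrightarrow> f y \<le> B x"
    using assms(2) by metis
  obtain T where T: "T \<subseteq> S" "finite T" "S \<subseteq> (\<Union>x\<in>T. ball x (e x))"
    using compactE_image [OF assms(1), of S "\<lambda>x. ball x (e x)"] e by force
  have "f y \<le> (\<Sum>x\<in>T. \<bar>B x\<bar>)" if y: "y \<in> S" for y
  proof -
    obtain x where x: "x \<in> T" "dist x y < e x" using T(3) y by auto
    have "f y \<le> \<bar>B x\<bar>" using B [of x y] x y T(1) by force
    also have "\<dots> \<le> (\<Sum>x\<in>T. \<bar>B x\<bar>)" using x T(2) by (intro member_le_sum) auto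
    finally show ?thesis .
  qed
  then show ?thesis by blast
qed

text \<open>For large t the point -t lies in the sector, since -t - a is a negative real with
  argument pi. On the remaining compact range a bound follows from local boundedness of the
  resolvent. The description by \<open>THE\<close> links R(t) to the integrand of
  \<open>frac_neg_pow\<close>.\<close>

lemma sectorial_resolvent_family:
  fixes D :: "'x::chilbert_space set" and A :: "'x \<Rightarrow> 'x"
  assumes sect: "sectorial D A" and res: "\<And>t. 0 \<le> t \<Longrightarrow> in_resolvent_set D A (- complex_of_real t)"
  obtains R :: "real \<Rightarrow> 'x \<Rightarrow>\<^sub>L 'x" and M where "resolvent_family R M"
    and "\<And>t x. 0 \<le> t \<Longrightarrow> R t x \<in> D \<and> t *\<^sub>R R t x + A (R t x) = x"
    and "\<And>t x. 0 \<le> t \<Longrightarrow> R t x = (THE y. y \<in> D \<and> t *\<^sub>R y + A y = x)"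
proof -
  have lin: "linear_op D A" using sect by (simp add: sectorial_def)
  have D_add: "x + y \<in> D" "A (x + y) = A x + A y" if "x \<in> D" "y \<in> D" for x y
    using lin that by (auto simp: linear_op_def)
  have D_scaleR: "c *\<^sub>R x \<in> D" "A (c *\<^sub>R x) = c *\<^sub>R A x" if "x \<in> D" for x c
    using lin that by (auto simp: linear_op_def scaleR_scaleC)
  define \<rho> where "\<rho> t x = (THE y. y \<in> D \<and> t *\<^sub>R y + A y = x)" for t :: real and x
  \<comment> \<open>The resolvent at l = -t inverts l - A = - (t + A), so the right-hand side
    changes sign.\<close>
  have shift: "(- complex_of_real t) *\<^sub>C y - A y = - x \<longleftrightarrow> t *\<^sub>R y + A y = x" for t x y
  proof -
    have "(- complex_of_real t) *\<^sub>C y = - (t *\<^sub>R y)"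
      using scaleR_scaleC [of "- t" y] by simp
    then show ?thesis by (metis add_uminus_conv_diff minus_add_distrib minus_equation_iff)
  qed
  have \<rho>_eq: "\<rho> t x = resolvent_op D A (- complex_of_real t) (- x)" for t x
    by (simp add: \<rho>_def resolvent_op_def shift)
  have ex1: "\<exists>!y. y \<in> D \<and> t *\<^sub>R y + A y = x" if "0 \<le> t" for t x
    using res [OF that] unfolding in_resolvent_set_def shift [symmetric] by blast
  have \<rho>: "\<rho> t x \<in> D" "t *\<^sub>R \<rho> t x + A (\<rho> t x) = x" if "0 \<le> t" for t x
    using theI' [OF ex1 [OF that]] unfolding \<rho>_def by blast+
  have \<rho>_unique: "\<rho> t x = y" if "0 \<le> t" "y \<in> D" "t *\<^sub>R y + A y = x" for t x y
    using ex1 [OF that(1)] that \<rho> by blast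
  have \<rho>_linear: "bounded_linear (\<rho> t)" if t: "0 \<le> t" for t
  proof -
    obtain C where C: "\<And>x. norm (resolvent_op D A (- complex_of_real t) x) \<le> C * norm x"
      using res [OF t] unfolding in_resolvent_set_def by blast
    show ?thesis
    proof (rule bounded_linear_intro [of _ C])
      fix x y
      have "t *\<^sub>R (\<rho> t x + \<rho> t y) + A (\<rho> t x + \<rho> t y) =
          (t *\<^sub>R \<rho> t x + A (\<rho> t x)) + (t *\<^sub>R \<rho> t y + A (\<rho> t y))"
        using \<rho>(1) [OF t] by (simp add: D_add scaleR_add_right)
      then show "\<rho> t (x + y) = \<rho> t x + \<rho> t y"
        using \<rho> [OF t] t by (intro \<rho>_unique D_add) auto
    next
      fix c x
      have "t *\<^sub>R (c *\<^sub>R \<rho> t x) + A (c *\<^sub>R \<rho> t x) = c *\<^sub>R (t *\<^sub>R \<rho> t x + A (\<rho> t x))"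
        using \<rho>(1) [OF t] by (simp add: D_scaleR scaleR_add_right mult.commute)
      then show "\<rho> t (c *\<^sub>R x) = c *\<^sub>R \<rho> t x"
        using \<rho> [OF t] t by (intro \<rho>_unique D_scaleR) auto
    next
      show "norm (\<rho> t x) \<le> norm x * C" for x
        using C [of "- x"] by (simp add: \<rho>_eq mult.commute)
    qed
  qed
  define R where "R t = Blinfun (\<rho> t)" for t
  have R_apply: "blinfun_apply (R t) = \<rho> t" if "0 \<le> t" for t
    using \<rho>_linear [OF that] by (simp add: R_def bounded_linear_Blinfun_apply)
  have identity: "R s - R t = (t - s) *\<^sub>R (R s o\<^sub>L R t)" if st: "0 \<le> s" "0 \<le> t" for s t
  proof (rule blinfun_eqI)
    fix x
    \<comment> \<open>The argument of R(s) is (s + A) R(t) x, rewritten by means of (t + A) R(t) x =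
      x.\<close>
    have "R s (x + (s - t) *\<^sub>R R t x) = R t x"
    proof -
      have "\<rho> s (x + (s - t) *\<^sub>R \<rho> t x) = \<rho> t x"
        using \<rho> [OF st(2), of x] st by (intro \<rho>_unique) (auto simp: algebra_simps)
      then show ?thesis using st by (simp add: R_apply)
    qed
    then have "R s x + (s - t) *\<^sub>R R s (R t x) = R t x"
      by (simp add: blinfun.add_right blinfun.scaleR_right)
    then show "(R s - R t) x = ((t - s) *\<^sub>R (R s o\<^sub>L R t)) x"
      by (simp add: blinfun.diff_left blinfun.scaleR_left algebra_simps)
  qed
  have "\<exists>M. \<forall>t\<ge>0. norm (R t) \<le> M / (1 + t)"
  proof -
    obtain a \<phi> K where \<phi>: "\<phi> < pi / 2" and K: "1 \<le> K" and
      sector: "\<And>l x. l \<noteq> complex_of_real a \<Longrightarrow> \<phi> \<le> \<bar>Arg (l - complex_of_real a)\<bar> \<Longrightarrow>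
        norm (resolvent_op D A l x) \<le> K / cmod (l - complex_of_real a) * norm x"
      using sect unfolding sectorial_def by blast
    \<comment> \<open>This threshold gives t + a \<ge> (1 + t) / 2 for t \<ge> T, which turns K / (t
      + a) into 2 K / (1 + t).\<close>
    define T where "T = 2 * \<bar>a\<bar> + 1"
    have far: "norm (R t) \<le> 2 * K / (1 + t)" if t: "T \<le> t" for t
    proof (rule norm_blinfun_bound)
      have t': "(1 + t) / 2 \<le> t + a" "0 < t" "0 < t + a" using t by (auto simp: T_def)
      show "0 \<le> 2 * K / (1 + t)" using K t' by simp
      fix x
      have eq: "- complex_of_real t - complex_of_real a = complex_of_real (- (t + a))" by simp
      have "norm (resolvent_op D A (- complex_of_real t) (- x)) \<le>
          K / cmod (- complex_of_real t - complex_of_real a) * norm (- x)"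
      proof (rule sector)
        show "- complex_of_real t \<noteq> complex_of_real a"
          using t' eq by (metis add.inverse_inverse less_irrefl neg_equal_0_iff_equal of_real_eq_0_iff right_minus_eq)
        show "\<phi> \<le> \<bar>Arg (- complex_of_real t - complex_of_real a)\<bar>"
          unfolding eq Arg_of_real using t' \<phi> pi_gt_zero by (simp, linarith)
      qed
      also have "\<dots> = K / (t + a) * norm x"
        unfolding eq norm_of_real using t' by simp
      also have "\<dots> \<le> K / ((1 + t) / 2) * norm x"
        using t' K by (intro mult_right_mono divide_left_mono) auto
      finally show "norm (R t x) \<le> 2 * K / (1 + t) * norm x"
        using t' by (simp add: R_apply \<rho>_eq mult.commute)
    qed
    have "\<exists>B. \<forall>t\<in>{0..T}. norm (R t) \<le> B"
    proof (rule locally_bounded_imp_bounded_on_compact)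
      fix s assume s: "s \<in> {0..T}"
      define c where "c = norm (R s) + 1"
      have c: "0 < c" by (simp add: c_def add_nonneg_pos)
      \<comment> \<open>The resolvent identity bounds the norm of R(t) by c plus half of itself, and
        the half is absorbed on the left. No continuity of R is presupposed.\<close>
      have "norm (R t) \<le> 2 * c" if t: "t \<in> {0..T}" "dist s t < 1 / (2 * c)" for t
      proof -
        have "R t = R s + (s - t) *\<^sub>R (R t o\<^sub>L R s)"
          using identity [of t s] s t by (simp add: algebra_simps)
        then have "norm (R t) \<le> norm (R s) + \<bar>s - t\<bar> * norm (R t o\<^sub>L R s)"
          using norm_triangle_ineq [of "R s" "(s - t) *\<^sub>R (R t o\<^sub>L R s)"] by simp
        also have "\<dots> \<le> c + 1 / (2 * c) * (norm (R t) * c)"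
        proof (intro add_mono mult_mono)
          show "norm (R t o\<^sub>L R s) \<le> norm (R t) * c"
            using norm_blinfun_compose [of "R t" "R s"] by (simp add: c_def distrib_left add_increasing2)
        qed (use t c in \<open>auto simp: c_def dist_real_def\<close>)
        finally show ?thesis using c by simp
      qed
      then show "\<exists>e>0. \<exists>B. \<forall>t\<in>{0..T}. dist s t < e \<longrightarrow> norm (R t) \<le> B"
        using c by (intro exI [of _ "1 / (2 * c)"] conjI exI [of _ "2 * c"]) auto
    qed simp
    then obtain B where B: "\<And>t. 0 \<le> t \<Longrightarrow> t \<le> T \<Longrightarrow> norm (R t) \<le> B"
      by (meson atLeastAtMost_iff)
    have T: "0 < T" by (simp add: T_def add_nonneg_pos)
    have "norm (R t) \<le> max (B * (1 + T)) (2 * K) / (1 + t)" if t: "0 \<le> t" for t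
    proof (cases "t \<le> T")
      case True
      have "0 \<le> B" using order_trans [OF norm_ge_zero B [of 0]] T by simp
      then have "norm (R t) * (1 + t) \<le> B * (1 + T)"
        using B True t by (intro mult_mono) auto
      then show ?thesis using t by (simp add: pos_le_divide_eq)
    next
      case False
      then have "norm (R t) \<le> 2 * K / (1 + t)" by (intro far) simp
      also have "\<dots> \<le> max (B * (1 + T)) (2 * K) / (1 + t)" using t by (intro divide_right_mono) auto
      finally show ?thesis .
    qed
    then show ?thesis by blast
  qed
  then obtain M where M: "\<And>t. 0 \<le> t \<Longrightarrow> norm (R t) \<le> M / (1 + t)" by blast
  show ?thesis
  proof (rule that)
    show "resolvent_family R M" by unfold_locales (fact M identity)+
    show "R t x \<in> D \<and> t *\<^sub>R R t x + A (R t x) = x" if "0 \<le> t" for t x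
      using \<rho> that by (simp add: R_apply)
    show "R t x = (THE y. y \<in> D \<and> t *\<^sub>R y + A y = x)" if "0 \<le> t" for t x
      using that by (simp add: R_apply \<rho>_def)
  qed
qed

section \<open>The vector at which dissipativity fails\<close>

theorem theorem5p2:
  fixes D :: "'x::chilbert_space set" and A :: "'x \<Rightarrow> 'x"
  assumes "separable TYPE('x)"
    and "sectorial D A"
    and "unbounded_op D A"
    and "compact_resolvent D A"
    and "\<exists>lam0>0. \<forall>l\<in>spectrum_op D A. Re l > lam0"
  shows "\<not> dissipative (Z_inner D A) (B1_dom D A) (\<lambda>U. - B1 D A U)
         \<and> (\<exists>U\<in>B1_dom D A. Re (Z_inner D A (- B1 D A U) U) > 0)"
proof -
  have res: "in_resolvent_set D A (- complex_of_real t)" if "0 \<le> t" for t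
    using assms(5) that by (force simp: spectrum_op_def)
  obtain R :: "real \<Rightarrow> 'x \<Rightarrow>\<^sub>L 'x" and M where "resolvent_family R M"
    and R: "\<And>t x. 0 \<le> t \<Longrightarrow> R t x \<in> D \<and> t *\<^sub>R R t x + A (R t x) = x"
    and R_the: "\<And>t x. 0 \<le> t \<Longrightarrow> R t x = (THE y. y \<in> D \<and> t *\<^sub>R y + A y = x)"
    using sectorial_resolvent_family [OF assms(2) res] by blast
  then interpret resolvent_family R M by simp
  have A_0: "A 0 = 0"
  proof -
    have "linear_op D A" using assms(2) by (simp add: sectorial_def)
    then have "0 \<in> D" "\<And>x. x \<in> D \<Longrightarrow> A (x + 0) = A x + A 0"
      unfolding linear_op_def by blast+
    from this(2) [OF this(1)] show ?thesis by simp
  qed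
  have R_0_inj: "x = 0" if "R 0 x = 0" for x
    using R [of 0 x] that A_0 by simp
  have pow: "frac_neg_pow D A \<alpha> = neg_pow \<alpha>" if "0 < \<alpha>" "\<alpha> < 1" for \<alpha>
  proof
    fix x
    have "integral {0<..} (\<lambda>t. t powr - \<alpha> *\<^sub>R (THE y. y \<in> D \<and> t *\<^sub>R y + A y = x)) =
        integral {0<..} (\<lambda>t. t powr - \<alpha> *\<^sub>R R t x)"
      by (rule Henstock_Kurzweil_Integration.integral_cong) (simp add: R_the)
    then show "frac_neg_pow D A \<alpha> x = neg_pow \<alpha> x"
      by (simp add: frac_neg_pow_def neg_pow_apply [OF that])
  qed
  have neg_pow_ker: "x = 0" if "0 < \<alpha>" "\<alpha> < 1" "neg_pow \<alpha> x = 0" for \<alpha> x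
  proof -
    \<comment> \<open>The functional is the real part of the inner product with R(0) x itself, so
      its vanishing at R(0) x kills the norm.\<close>
    have "Re (cinner (R 0 x) (R 0 x)) = 0"
      using that bounded_linear_Re_cinner by (rule functional_R_0_eq_0)
    then have "R 0 x = 0" by (simp add: Re_cinner_self)
    then show ?thesis by (rule R_0_inj)
  qed
  have neg_pow_inj: "x = y" if "0 < \<alpha>" "\<alpha> < 1" "neg_pow \<alpha> x = neg_pow \<alpha> y" for \<alpha> x y
    using neg_pow_ker [OF that(1,2), of "x - y"] that(3) by (simp add: blinfun.diff_right)
  \<comment> \<open>Injectivity makes the preimage described by \<open>THE\<close> in
    \<open>frac_pow\<close> unique, so A^\<alpha> really inverts A^-\<alpha>.\<close>
  have frac_dom: "neg_pow \<alpha> x \<in> frac_dom D A \<alpha>" and frac_pow: "frac_pow D A \<alpha> (neg_pow \<alpha> x) = x"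
    if "0 < \<alpha>" "\<alpha> < 1" for \<alpha> x
    using that neg_pow_inj [OF that] by (auto simp: frac_dom_def frac_pow_def pow [OF that])
  let ?P = "neg_pow (1/3)" and ?Q = "neg_pow (2/3)"
  have comm: "R 0 (?P x) = ?P (R 0 x)" "R 0 (?Q x) = ?Q (R 0 x)" "?P (?Q x) = ?Q (?P x)" for x
    using arg_cong [OF R_neg_pow_commute [of "1/3" 0], of "\<lambda>T. T x"]
      arg_cong [OF R_neg_pow_commute [of "2/3" 0], of "\<lambda>T. T x"]
      arg_cong [OF neg_pow_neg_pow_commute [of "1/3" "2/3"], of "\<lambda>T. T x"] by auto
  \<comment> \<open>On the zero space the constant C = 0 would bound A, so unboundedness yields a
    nonzero vector.\<close>
  obtain z :: 'x where z: "z \<noteq> 0"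
    using assms(3) A_0 unfolding unbounded_op_def by (metis mult_zero_left norm_zero order_refl)
  \<comment> \<open>The vector q is A^(2/3) u for the u below. Reordering the commuting factors of u
    puts A^-1 or A^(-1/3) outermost as needed; A^(2/3) A^(1/3) u then comes out as R(0) z, without
    any addition law for exponents.\<close>
  define q where "q = R 0 (?P z)"
  have q: "q \<noteq> 0"
    using R_0_inj [of "?P z"] neg_pow_ker [of "1/3" z] z by (auto simp: q_def)
  \<comment> \<open>Chosen so that \<open>\<tau>\<close> times the squared norm of q exceeds the
    real part of <R(0) z, q> by exactly 1.\<close>
  define \<tau> where "\<tau> = (Re (cinner (R 0 z) q) + 1) / (norm q)\<^sup>2"
  define u where "u = ?Q q"
  define U where "U = (u, \<tau> *\<^sub>R u, 0::'x)"
  have u_P: "u = ?P (?Q (R 0 z))" by (simp add: u_def q_def comm)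
  have u_D: "u \<in> D" using R [of 0 "?Q (?P z)"] by (simp add: u_def q_def comm)
  have \<tau>u: "\<tau> *\<^sub>R u = ?Q (\<tau> *\<^sub>R q)" by (simp add: u_def blinfun.scaleR_right)
  have dom: "U \<in> B1_dom D A"
    using u_D frac_dom [of "2/3" "\<tau> *\<^sub>R q"] frac_dom [of "1/3" 0]
    by (simp add: U_def B1_dom_def \<tau>u blinfun.zero_right) (simp add: frac_dom_def)
  have "frac_pow D A (1/3) u = ?Q (R 0 z)"
    unfolding u_P by (rule frac_pow) auto
  then have BU: "- B1 D A U = (?Q (\<tau> *\<^sub>R q - R 0 z), 0, - frac_pow D A (2/3) (\<tau> *\<^sub>R u))"
    by (simp add: U_def B1_def \<tau>u blinfun.diff_right)
  have frac_pow_0: "frac_pow D A (1/3) 0 = 0"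
    using frac_pow [of "1/3" 0] by (simp add: blinfun.zero_right)
  \<comment> \<open>Since w = 0, the second component of -B U is 0 and the third is paired with 0.
    Only the first contributes, and A^(2/3) sends it to \<open>\<tau>\<close> q - R(0) z.\<close>
  have "Z_inner D A (- B1 D A U) U = cinner (\<tau> *\<^sub>R q - R 0 z) q"
    unfolding BU by (simp add: U_def Z_inner_def frac_inner_def frac_pow frac_pow_0 u_def)
  then have "Re (Z_inner D A (- B1 D A U) U) = \<tau> * (norm q)\<^sup>2 - Re (cinner (R 0 z) q)"
    by (simp add: cinner_diff_left cinner_scaleR_left Re_cinner_self)
  also have "\<dots> = 1" using q by (simp add: \<tau>_def)
  finally have "0 < Re (Z_inner D A (- B1 D A U) U)" by simp
  with dom show ?thesis
    unfolding dissipative_def by (meson not_le)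
qed

end
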